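(* For every set $\Gamma\subseteq\mathcal{L}_{ELKy^r}$ and every $\phi\in\mathcal{L}_{ELKy^r}$, if $\Gamma\models\phi$ over the class of all $\mathcal{S}5$-$\mathbf{ELKy^r}$-models, then $\Gamma\vdash_{\mathbb{SKYR}}\phi$.
   Context: Fix a countable set of agents $\mathcal{A}$ and a countably infinite set of atoms $\mathcal{P}$. $\mathcal{L}_{ELKy^r}$: $\phi ::= p\mid\neg\phi\mid(\phi\land\phi)\mid K_a\phi\mid Ky_a^r(\phi,\phi)$; $\to,\top,\bot$ as usual. $\Lambda\subseteq\mathcal{L}_{ELKy^r}$ is a fixed set of formulas valid in the class below (tautology ground). An $\mathcal{S}5$-$\mathbf{ELKy^r}$-model is $\mathfrak{M}=\langle W,E,\{R_a\}_{a\in\mathcal{A}},\mathcal{E},V\rangle$ with $W\neq\emptyset$; $E$ nonempty, containing a designated $e$, closed under a binary operation $\cdot$; each $R_a$ an equivalence relation on $W$; $\mathcal{E}:E\times\mathcal{L}_{ELKy^r}\to 2^W$ with $\mathcal{E}(e,\phi)=W$ for $\phi\in\Lambda$ and $\mathcal{E}(s,\phi\to\psi)\cap\mathcal{E}(t,\phi)\subseteq\mathcal{E}(s\cdot t,\psi)$; $V:\mathcal{P}\to 2^W$. Truth: $p,\neg,\land$ as usual; $K_a\phi$ holds at $w$ iff $\phi$ holds at all $R_a$-successors; $Ky_a^r(\phi,\psi)$ holds at $w$ iff there is $t\in E$ such that every $v$ with $(w,v)\in R_a$ and $(\mathfrak{M},v)\models\phi$ satisfies $v\in\mathcal{E}(t,\psi)$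 and $(\mathfrak{M},v)\models\psi$. $\Gamma\models\phi$ (local consequence) means: for every model and world where all of $\Gamma$ holds, $\phi$ holds. $\mathbb{SKYR}$ has, for all agents and formulas: (PT) propositional tautologies; (K) $K_a(\phi\to\psi)\to(K_a\phi\to K_a\psi)$; (T) $K_a\phi\to\phi$; (4) $K_a\phi\to K_aK_a\phi$; (5) $\neg K_a\phi\to K_a\neg K_a\phi$; (EKyR) $Ky_a^r(\chi,\phi\to\psi)\to(Ky_a^r(\theta,\phi)\to Ky_a^r(\chi\land\theta,\psi))$; (4YKR) $Ky_a^r(\phi,\psi)\to K_aKy_a^r(\phi,\psi)$; (DKyR) $Ky_a^r(\phi,\psi)\to K_a(\phi\to\psi)$; (IKyR) $Ky_a^r(\psi,\chi)\to(K_a(\phi\to\psi)\to Ky_a^r(\phi,\chi))$; (UKyR) $K_a\neg\phi\to Ky_a^r(\phi,\psi)$; rules (MP); (NK) from $\vdash\phi$ infer $\vdash K_a\phi$; (NKyR) from $\phi\in\Lambda$ infer $\vdash Ky_a^r(\top,\phi)$. $\Gamma\vdash\phi$ means $\phi$ follows from $\Gamma$ and theorems of $\mathbb{SKYR}$ by (MP). *)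

theory Defs
  imports "HOL-Library.Countable_Set" "HOL-Library.Infinite_Typeclass"
begin

datatype ('a, 'p) fm =
    Atom 'p
  | Neg "('a, 'p) fm"
  | Conj "('a, 'p) fm" "('a, 'p) fm"
  | K 'a "('a, 'p) fm"
  | Ky 'a "('a, 'p) fm" "('a, 'p) fm"

instance fm :: (countable, countable) countable
  by countable_datatype

abbreviation Imp :: "('a, 'p) fm \<Rightarrow> ('a, 'p) fm \<Rightarrow> ('a, 'p) fm" where
  "Imp \<phi> \<psi> \<equiv> Neg (Conj \<phi> (Neg \<psi>))"

text \<open>Here \<open>undefined\<close> merely denotes some fixed atom.\<close>

abbreviation Top :: "('a, 'p) fm" where
  "Top \<equiv> Neg (Conj (Atom undefined) (Neg (Atom undefined)))"


subsection \<open>Models\<close>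

record ('a, 'p, 'w, 'e) model =
  worlds :: "'w set"
  expls :: "'e set"
  unit_expl :: 'e
  app_expl :: "'e \<Rightarrow> 'e \<Rightarrow> 'e"
  rel :: "'a \<Rightarrow> ('w \<times> 'w) set"
  adm :: "'e \<Rightarrow> ('a, 'p) fm \<Rightarrow> 'w set"
  val :: "'p \<Rightarrow> 'w set"

definition s5_model :: "('a, 'p) fm set \<Rightarrow> ('a, 'p, 'w, 'e) model \<Rightarrow> bool" where
  "s5_model \<Lambda> M \<longleftrightarrow>
     worlds M \<noteq> {} \<and>
     unit_expl M \<in> expls M \<and>
     (\<forall>s\<in>expls M. \<forall>t\<in>expls M. app_expl M s t \<in> expls M) \<and>
     (\<forall>a. equiv (worlds M) (rel M a)) \<and>
     (\<forall>t\<in>expls M. \<forall>\<phi>. adm M t \<phi> \<subseteq> worlds M) \<and>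
     (\<forall>\<phi>\<in>\<Lambda>. adm M (unit_expl M) \<phi> = worlds M) \<and>
     (\<forall>s\<in>expls M. \<forall>t\<in>expls M. \<forall>\<phi> \<psi>.
        adm M s (Imp \<phi> \<psi>) \<inter> adm M t \<phi> \<subseteq> adm M (app_expl M s t) \<psi>) \<and>
     (\<forall>p. val M p \<subseteq> worlds M)"

primrec sat :: "('a, 'p, 'w, 'e) model \<Rightarrow> 'w \<Rightarrow> ('a, 'p) fm \<Rightarrow> bool" where
  "sat M w (Atom p) \<longleftrightarrow> w \<in> val M p"
| "sat M w (Neg \<phi>) \<longleftrightarrow> \<not> sat M w \<phi>"
| "sat M w (Conj \<phi> \<psi>) \<longleftrightarrow> sat M w \<phi> \<and> sat M w \<psi>"
| "sat M w (K a \<phi>) \<longleftrightarrow> (\<forall>v. (w, v) \<in> rel M a \<longrightarrow> sat M v \<phi>)"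
| "sat M w (Ky a \<phi> \<psi>) \<longleftrightarrow>
     (\<exists>t\<in>expls M. \<forall>v. (w, v) \<in> rel M a \<and> sat M v \<phi> \<longrightarrow> v \<in> adm M t \<psi> \<and> sat M v \<psi>)"

text \<open>HOL cannot quantify over types inside a formula, so local consequence refers to the models
  whose worlds and explanations are drawn from two given types. Lemma \<open>consequence_all_types\<close>
  below shows that over any two infinite types it amounts to consequence over all models.\<close>

definition consequence ::
  "'w itself \<Rightarrow> 'e itself \<Rightarrow> ('a, 'p) fm set \<Rightarrow> ('a, 'p) fm set \<Rightarrow> ('a, 'p) fm \<Rightarrow> bool" where
  "consequence _ _ \<Lambda> \<Gamma> \<phi> \<longleftrightarrow>
     (\<forall>M :: ('a, 'p, 'w, 'e) model. s5_model \<Lambda> M \<longrightarrow>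
        (\<forall>w\<in>worlds M. (\<forall>\<gamma>\<in>\<Gamma>. sat M w \<gamma>) \<longrightarrow> sat M w \<phi>))"

abbreviation valid :: "'w itself \<Rightarrow> 'e itself \<Rightarrow> ('a, 'p) fm set \<Rightarrow> ('a, 'p) fm \<Rightarrow> bool" where
  "valid TW TE \<Lambda> \<phi> \<equiv> consequence TW TE \<Lambda> {} \<phi>"


subsection \<open>The proof system\<close>

primrec peval :: "(('a, 'p) fm \<Rightarrow> bool) \<Rightarrow> ('a, 'p) fm \<Rightarrow> bool" where
  "peval h (Atom p) \<longleftrightarrow> h (Atom p)"
| "peval h (Neg \<phi>) \<longleftrightarrow> \<not> peval h \<phi>"
| "peval h (Conj \<phi> \<psi>) \<longleftrightarrow> peval h \<phi> \<and> peval h \<psi>"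
| "peval h (K a \<phi>) \<longleftrightarrow> h (K a \<phi>)"
| "peval h (Ky a \<phi> \<psi>) \<longleftrightarrow> h (Ky a \<phi> \<psi>)"

definition tautology :: "('a, 'p) fm \<Rightarrow> bool" where
  "tautology \<phi> \<longleftrightarrow> (\<forall>h. peval h \<phi>)"

inductive SKYR :: "('a, 'p) fm set \<Rightarrow> ('a, 'p) fm \<Rightarrow> bool" for \<Lambda> where
  PT: "tautology \<phi> \<Longrightarrow> SKYR \<Lambda> \<phi>"
| AxK: "SKYR \<Lambda> (Imp (K a (Imp \<phi> \<psi>)) (Imp (K a \<phi>) (K a \<psi>)))"
| AxT: "SKYR \<Lambda> (Imp (K a \<phi>) \<phi>)"
| Ax4: "SKYR \<Lambda> (Imp (K a \<phi>) (K a (K a \<phi>)))"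
| Ax5: "SKYR \<Lambda> (Imp (Neg (K a \<phi>)) (K a (Neg (K a \<phi>))))"
| EKyR: "SKYR \<Lambda> (Imp (Ky a \<chi> (Imp \<phi> \<psi>)) (Imp (Ky a \<theta> \<phi>) (Ky a (Conj \<chi> \<theta>) \<psi>)))"
| YKR4: "SKYR \<Lambda> (Imp (Ky a \<phi> \<psi>) (K a (Ky a \<phi> \<psi>)))"
| DKyR: "SKYR \<Lambda> (Imp (Ky a \<phi> \<psi>) (K a (Imp \<phi> \<psi>)))"
| IKyR: "SKYR \<Lambda> (Imp (Ky a \<psi> \<chi>) (Imp (K a (Imp \<phi> \<psi>)) (Ky a \<phi> \<chi>)))"
| UKyR: "SKYR \<Lambda> (Imp (K a (Neg \<phi>)) (Ky a \<phi> \<psi>))"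
| MP: "SKYR \<Lambda> (Imp \<phi> \<psi>) \<Longrightarrow> SKYR \<Lambda> \<phi> \<Longrightarrow> SKYR \<Lambda> \<psi>"
| NK: "SKYR \<Lambda> \<phi> \<Longrightarrow> SKYR \<Lambda> (K a \<phi>)"
| NKyR: "\<phi> \<in> \<Lambda> \<Longrightarrow> SKYR \<Lambda> (Ky a Top \<phi>)"

inductive derives :: "('a, 'p) fm set \<Rightarrow> ('a, 'p) fm set \<Rightarrow> ('a, 'p) fm \<Rightarrow> bool" for \<Lambda> \<Gamma> where
  Prem: "\<phi> \<in> \<Gamma> \<Longrightarrow> derives \<Lambda> \<Gamma> \<phi>"
| Thm: "SKYR \<Lambda> \<phi> \<Longrightarrow> derives \<Lambda> \<Gamma> \<phi>"
| Der_MP: "derives \<Lambda> \<Gamma> (Imp \<phi> \<psi>) \<Longrightarrow> derives \<Lambda> \<Gamma> \<phi> \<Longrightarrow> derives \<Lambda> \<Gamma> \<psi>"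


subsection \<open>Independence of the carrier types\<close>

lemma countable_witness_closure:
  fixes P :: "'x \<Rightarrow> 'x \<Rightarrow> 'i::countable \<Rightarrow> 'x \<Rightarrow> bool"
  assumes X: "countable X" "X \<subseteq> U" and P: "\<And>x y i z. P x y i z \<Longrightarrow> z \<in> U"
  obtains C where "countable C" "X \<subseteq> C" "C \<subseteq> U"
    "\<And>x y i z. x \<in> C \<Longrightarrow> y \<in> C \<Longrightarrow> P x y i z \<Longrightarrow> \<exists>z\<in>C. P x y i z"
proof -
  define F where "F x y i = (if \<exists>z. P x y i z then SOME z. P x y i z else x)" for x y i
  define S where "S = rec_nat X (\<lambda>_ A. A \<union> (\<lambda>(x, y, i). F x y i) ` (A \<times> A \<times> UNIV))"
  have S0: "S 0 = X" and
    SS: "S (Suc n) = S n \<union> (\<lambda>(x, y, i). F x y i) ` (S n \<times> S n \<times> UNIV)" for n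
    by (simp_all add: S_def)
  have F: "P x y i (F x y i)" if "P x y i z" for x y i z
    using that someI_ex[of "P x y i"] by (auto simp: F_def)
  have FU: "F x y i \<in> U" if "x \<in> U" for x y i
  proof (cases "\<exists>z. P x y i z")
    case True
    then show ?thesis using F P by blast
  next
    case False
    then show ?thesis using that by (simp add: F_def)
  qed
  have cnt: "countable (S n)" for n
    by (induction n) (auto simp: S0 SS X)
  have sub: "S n \<subseteq> U" for n
    by (induction n) (use X FU in \<open>auto simp: S0 SS\<close>)
  have mono: "S m \<subseteq> S n" if "m \<le> n" for m n
    by (rule lift_Suc_mono_le[of S, OF _ that]) (auto simp: SS)
  show ?thesis
  proof (rule that[of "\<Union>n. S n"])
    fix x y i z assume x: "x \<in> (\<Union>n. S n)" and y: "y \<in> (\<Union>n. S n)" and z: "P x y i z"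
    obtain m n where "x \<in> S m" "y \<in> S n" using x y by blast
    then have "x \<in> S (max m n)" "y \<in> S (max m n)"
      using mono[of m "max m n"] mono[of n "max m n"] by auto
    then have "F x y i \<in> S (Suc (max m n))"
      by (force simp: SS)
    then show "\<exists>z\<in>\<Union>n. S n. P x y i z" using F[OF z] by blast
  qed (use cnt sub S0 in auto)
qed

lemma countable_range_infinite:
  assumes "countable C" "C \<noteq> {}"
  obtains f :: "'w::infinite \<Rightarrow> 'c" where "range f = C"
proof -
  obtain g :: "nat \<Rightarrow> 'w" where g: "inj g"
    using infinite_countable_subset[OF infinite_UNIV] by blast
  have "range (from_nat_into C \<circ> inv g) = C"
    using assms g inj_imp_surj_inv[OF g] by (metis image_comp range_from_nat_into)
  then show ?thesis using that by blast
qed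

lemma consequence_all_types:
  fixes \<Lambda> \<Gamma> :: "('a::countable, 'p::countable) fm set"
  assumes cons: "consequence TYPE('w::infinite) TYPE('e::infinite) \<Lambda> \<Gamma> \<phi>"
  shows "consequence TYPE('v) TYPE('f) \<Lambda> \<Gamma> \<phi>"
  unfolding consequence_def
proof (intro allI ballI impI)
  fix M :: "('a, 'p, 'v, 'f) model" and w0
  assume M: "s5_model \<Lambda> M" and w0: "w0 \<in> worlds M" and sat0: "\<forall>\<gamma>\<in>\<Gamma>. sat M w0 \<gamma>"
  define U where "U = Inl ` worlds M \<union> Inr ` expls M"
  define P :: "'v + 'f \<Rightarrow> 'v + 'f \<Rightarrow> 'a \<times> ('a, 'p) fm \<times> ('a, 'p) fm \<times> bool \<Rightarrow> 'v + 'f \<Rightarrow> bool"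
    where "P x y i z \<longleftrightarrow> z \<in> U \<and> (case i of (a, \<phi>, \<psi>, b) \<Rightarrow>
      (case (x, y) of
        (Inr s, Inr t) \<Rightarrow> z = Inr (app_expl M s t)
      | (Inl w, Inl _) \<Rightarrow>
          (if b then \<exists>v. z = Inl v \<and> (w, v) \<in> rel M a \<and> \<not> sat M v \<phi>
           else \<exists>t. z = Inr t \<and>
             (\<forall>v. (w, v) \<in> rel M a \<and> sat M v \<phi> \<longrightarrow> v \<in> adm M t \<psi> \<and> sat M v \<psi>))
      | (Inl w, Inr t) \<Rightarrow>
          \<exists>v. z = Inl v \<and> (w, v) \<in> rel M a \<and> sat M v \<phi> \<and> \<not> (v \<in> adm M t \<psi> \<and> sat M v \<psi>)
      | _ \<Rightarrow> False))" for x y i z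
  have eU: "unit_expl M \<in> expls M" using M by (simp add: s5_model_def)
  have PU: "\<And>x y i z. P x y i z \<Longrightarrow> z \<in> U" by (simp add: P_def)
  have cX: "countable {Inl w0, Inr (unit_expl M)}" by simp
  have XU: "{Inl w0, Inr (unit_expl M)} \<subseteq> U" using w0 eU by (simp add: U_def)
  obtain C where C: "countable C" "{Inl w0, Inr (unit_expl M)} \<subseteq> C" "C \<subseteq> U"
    and cl: "\<And>x y i z. x \<in> C \<Longrightarrow> y \<in> C \<Longrightarrow> P x y i z \<Longrightarrow> \<exists>z\<in>C. P x y i z"
    by (rule countable_witness_closure[where P = P, OF cX XU PU]) blast+
  define CW where "CW = Inl -` C"
  define CE where "CE = Inr -` C"
  have "Inl ` CW \<subseteq> C" "Inr ` CE \<subseteq> C" by (auto simp: CW_def CE_def)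
  then have "countable (Inl ` CW :: ('v + 'f) set)" "countable (Inr ` CE :: ('v + 'f) set)"
    using C(1) countable_subset by blast+
  then have "countable CW" "countable CE"
    by (auto dest: countable_image_inj_on)
  moreover have "CW \<subseteq> worlds M" "CE \<subseteq> expls M"
    using C(3) by (auto simp: CW_def CE_def U_def)
  ultimately have CW: "countable CW" "w0 \<in> CW" "CW \<subseteq> worlds M"
    and CE: "countable CE" "unit_expl M \<in> CE" "CE \<subseteq> expls M"
    using C(2) by (simp_all add: CW_def CE_def)
  have relM: "equiv (worlds M) (rel M a)" for a
    using M by (simp add: s5_model_def)
  have relW: "v \<in> worlds M" if "(w, v) \<in> rel M a" for w v a
    using relM[of a] that by (auto simp: equiv_def)
  have cl_app: "app_expl M s t \<in> CE" if "s \<in> CE" "t \<in> CE" for s t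
  proof -
    have "app_expl M s t \<in> expls M"
      using that CE(3) M unfolding s5_model_def by blast
    then have "P (Inr s) (Inr t) (undefined, undefined, undefined, True) (Inr (app_expl M s t))"
      by (simp add: P_def U_def)
    from cl[OF _ _ this] that show ?thesis by (auto simp: CE_def P_def)
  qed
  have cl_K: "\<exists>v\<in>CW. (w, v) \<in> rel M a \<and> \<not> sat M v \<phi>"
    if "w \<in> CW" "(w, v) \<in> rel M a" "\<not> sat M v \<phi>" for w v a \<phi>
  proof -
    have "P (Inl w) (Inl w) (a, \<phi>, \<phi>, True) (Inl v)"
      using that relW by (auto simp: P_def U_def)
    from cl[OF _ _ this] that show ?thesis by (auto simp: CW_def P_def)
  qed
  have cl_Ky: "\<exists>t\<in>CE. \<forall>v. (w, v) \<in> rel M a \<and> sat M v \<phi> \<longrightarrow> v \<in> adm M t \<psi> \<and> sat M v \<psi>"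
    if "w \<in> CW" "t \<in> expls M"
      "\<forall>v. (w, v) \<in> rel M a \<and> sat M v \<phi> \<longrightarrow> v \<in> adm M t \<psi> \<and> sat M v \<psi>" for w t a \<phi> \<psi>
  proof -
    have "P (Inl w) (Inl w) (a, \<phi>, \<psi>, False) (Inr t)"
      using that by (auto simp: P_def U_def)
    from cl[OF _ _ this] that show ?thesis by (auto simp: CW_def CE_def P_def)
  qed
  have cl_nKy: "\<exists>v\<in>CW. (w, v) \<in> rel M a \<and> sat M v \<phi> \<and> \<not> (v \<in> adm M t \<psi> \<and> sat M v \<psi>)"
    if "w \<in> CW" "t \<in> CE" "(w, v) \<in> rel M a" "sat M v \<phi>" "\<not> (v \<in> adm M t \<psi> \<and> sat M v \<psi>)"
    for w t v a \<phi> \<psi>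
  proof -
    have "P (Inl w) (Inr t) (a, \<phi>, \<psi>, True) (Inl v)"
      using that relW by (auto simp: P_def U_def)
    from cl[OF _ _ this] that show ?thesis by (auto simp: CW_def CE_def P_def)
  qed
  obtain l :: "'w \<Rightarrow> 'v" where l: "range l = CW"
    using countable_range_infinite[of CW] CW by blast
  obtain d :: "'e \<Rightarrow> 'f" where d: "range d = CE"
    using countable_range_infinite[of CE] CE by blast
  define d' where "d' = inv d"
  have dd': "d (d' t) = t" if "t \<in> CE" for t
    using that d by (auto simp: d'_def f_inv_into_f)
  have lW: "l x \<in> CW" "l x \<in> worlds M" and dE: "d s \<in> CE" "d s \<in> expls M" for x s
    using l d CW CE by auto
  define N :: "('a, 'p, 'w, 'e) model" where
    "N = \<lparr> worlds = UNIV, expls = UNIV, unit_expl = d' (unit_expl M),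
           app_expl = (\<lambda>s t. d' (app_expl M (d s) (d t))),
           rel = (\<lambda>a. {(x, y). (l x, l y) \<in> rel M a}),
           adm = (\<lambda>t \<phi>. {x. l x \<in> adm M (d t) \<phi>}),
           val = (\<lambda>p. {x. l x \<in> val M p}) \<rparr>"
  have eqN: "equiv UNIV {(x, y). (l x, l y) \<in> rel M a}" for a
  proof (rule equivI)
    show "refl_on UNIV {(x, y). (l x, l y) \<in> rel M a}"
      using relM[of a] lW by (auto simp: equiv_def refl_on_def)
    show "sym {(x, y). (l x, l y) \<in> rel M a}"
      using relM[of a] by (auto simp: equiv_def sym_def)
    show "trans {(x, y). (l x, l y) \<in> rel M a}"
      using relM[of a] unfolding equiv_def trans_def by blast
  qed simp
  have appM: "v \<in> adm M (app_expl M (d s) (d t)) \<psi>"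
    if "v \<in> adm M (d s) (Imp \<phi> \<psi>)" "v \<in> adm M (d t) \<phi>" for s t \<phi> \<psi> v
    using M dE(2)[of s] dE(2)[of t] that unfolding s5_model_def by blast
  have unitM: "adm M (unit_expl M) \<phi> = worlds M" if "\<phi> \<in> \<Lambda>" for \<phi>
    using M that by (simp add: s5_model_def)
  have N: "s5_model \<Lambda> N"
    using lW by (auto simp: s5_model_def N_def eqN dd' cl_app dE CE unitM intro: appM)
  have sat: "sat N x \<chi> \<longleftrightarrow> sat M (l x) \<chi>" for x \<chi>
  proof (induction \<chi> arbitrary: x)
    case (K a \<chi>)
    have "sat N x (K a \<chi>) \<longleftrightarrow> (\<forall>v\<in>CW. (l x, v) \<in> rel M a \<longrightarrow> sat M v \<chi>)"
      by (simp add: K.IH) (auto simp: N_def l[symmetric])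
    also have "\<dots> \<longleftrightarrow> sat M (l x) (K a \<chi>)"
      using cl_K[of "l x" _ a \<chi>] lW by auto
    finally show ?case .
  next
    case (Ky a \<chi> \<theta>)
    have "sat N x (Ky a \<chi> \<theta>) \<longleftrightarrow> (\<exists>t\<in>CE. \<forall>v\<in>CW. (l x, v) \<in> rel M a \<and> sat M v \<chi> \<longrightarrow>
        v \<in> adm M t \<theta> \<and> sat M v \<theta>)"
      by (simp add: Ky.IH) (auto simp: N_def l[symmetric] d[symmetric])
    also have "\<dots> \<longleftrightarrow> (\<exists>t\<in>CE. \<forall>v. (l x, v) \<in> rel M a \<and> sat M v \<chi> \<longrightarrow>
        v \<in> adm M t \<theta> \<and> sat M v \<theta>)"
      using cl_nKy[of "l x" _ _ a \<chi> \<theta>] lW by meson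
    also have "\<dots> \<longleftrightarrow> sat M (l x) (Ky a \<chi> \<theta>)"
      using cl_Ky[of "l x" _ a \<chi> \<theta>] lW CE by (auto; meson subsetD)
    finally show ?case .
  qed (auto simp: N_def)
  obtain x0 where x0: "l x0 = w0" using l CW by (metis imageE)
  have "x0 \<in> worlds N" by (simp add: N_def)
  moreover have "\<forall>\<gamma>\<in>\<Gamma>. sat N x0 \<gamma>" using sat0 by (simp add: sat x0)
  ultimately have "sat N x0 \<phi>" using cons N by (simp add: consequence_def)
  then show "sat M w0 \<phi>" by (simp add: sat x0)
qed

end

theory Submission
  imports Defs
begin

text \<open>A canonical model argument. An agent \<open>b\<close> may hold a different explanation in each of its
  cells, so a canonical explanation has to be tied to one cell of one agent. For this a world is a
  maximal consistent set together with a tag in the natural numbers for every agent, and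
  \<open>a\<close>-accessibility preserves the tag of \<open>a\<close> only. A term built from cell-bound witnesses mentions
  finitely many tags, so if it works at all \<open>\<phi>\<close>-worlds of an \<open>a\<close>-cell, then it works at those whose
  other tags are fresh; there only witnesses of \<open>a\<close> can be active. Since every witness explains
  exactly one formula, the formulas that a term explains are the same wherever it is active, and it
  is active only where the conjunction \<open>\<chi>\<close> of the conditions of its witnesses holds. The axioms
  EKyR and NKyR then yield \<open>Ky a \<chi> \<psi>\<close>, and IKyR weakens the condition to \<open>\<phi>\<close>.\<close>

section \<open>Maximal consistent sets\<close>

lemma derives_taut: "tautology \<phi> \<Longrightarrow> derives \<Lambda> \<Gamma> \<phi>"
  by (intro Thm PT)

lemma derives_mono: "derives \<Lambda> \<Gamma> \<phi> \<Longrightarrow> \<Gamma> \<subseteq> \<Delta> \<Longrightarrow> derives \<Lambda> \<Delta> \<phi>"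
  by (induction rule: derives.induct) (auto intro: derives.intros)

lemma deduction:
  assumes "derives \<Lambda> (insert \<chi> \<Gamma>) \<phi>"
  shows "derives \<Lambda> \<Gamma> (Imp \<chi> \<phi>)"
  using assms
proof (induction rule: derives.induct)
  case (Prem \<phi>)
  show ?case
  proof (cases "\<phi> = \<chi>")
    case True
    then show ?thesis by (auto intro: derives_taut simp: tautology_def)
  next
    case False
    then have "derives \<Lambda> \<Gamma> \<phi>" using Prem by (auto intro: derives.Prem)
    moreover have "derives \<Lambda> \<Gamma> (Imp \<phi> (Imp \<chi> \<phi>))"
      by (auto intro: derives_taut simp: tautology_def)
    ultimately show ?thesis by (rule Der_MP[rotated])
  qed
next
  case (Thm \<phi>)
  moreover have "derives \<Lambda> \<Gamma> (Imp \<phi> (Imp \<chi> \<phi>))"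
    by (auto intro: derives_taut simp: tautology_def)
  ultimately show ?case by (blast intro: derives.Thm Der_MP)
next
  case (Der_MP \<phi> \<psi>)
  have "derives \<Lambda> \<Gamma> (Imp (Imp \<chi> (Imp \<phi> \<psi>)) (Imp (Imp \<chi> \<phi>) (Imp \<chi> \<psi>)))"
    by (auto intro: derives_taut simp: tautology_def)
  then show ?case using Der_MP.IH by (blast intro: derives.Der_MP)
qed

text \<open>At modus ponens two members of the chain are involved; the larger one derives both
  premises of the rule.\<close>

lemma derives_chain_Union:
  assumes "derives \<Lambda> (\<Union>C) \<phi>" "subset.chain A C" "C \<noteq> {}"
  shows "\<exists>\<Delta>\<in>C. derives \<Lambda> \<Delta> \<phi>"
  using assms(1)
proof (induction rule: derives.induct)
  case (Der_MP \<phi> \<psi>)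
  then obtain X Y where XY: "X \<in> C" "Y \<in> C" "derives \<Lambda> X (Imp \<phi> \<psi>)" "derives \<Lambda> Y \<phi>"
    by blast
  then have "X \<subseteq> Y \<or> Y \<subseteq> X" using assms(2) by (auto simp: subset_chain_def)
  then show ?case using XY by (meson derives.Der_MP derives_mono)
qed (use assms(3) in \<open>auto intro: derives.intros\<close>)

text \<open>Deductive closure is not demanded: by \<open>mcs_derives\<close> it follows from
  consistency and completeness. \<open>Neg Top\<close> stands for falsum.\<close>

definition mcs :: "('a, 'p) fm set \<Rightarrow> ('a, 'p) fm set \<Rightarrow> bool" where
  "mcs \<Lambda> \<Delta> \<longleftrightarrow> \<not> derives \<Lambda> \<Delta> (Neg Top) \<and> (\<forall>\<chi>. \<chi> \<in> \<Delta> \<or> Neg \<chi> \<in> \<Delta>)"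

text \<open>Zorn's lemma is applied to the extensions of \<Gamma> that do not derive \<phi>, not to
  all consistent ones, so that a maximal one also omits \<phi>.\<close>

lemma lindenbaum:
  assumes "\<not> derives \<Lambda> \<Gamma> \<phi>"
  obtains \<Delta> where "mcs \<Lambda> \<Delta>" "\<Gamma> \<subseteq> \<Delta>" "\<phi> \<notin> \<Delta>"
proof -
  define A where "A = {\<Delta>. \<Gamma> \<subseteq> \<Delta> \<and> \<not> derives \<Lambda> \<Delta> \<phi>}"
  have "\<Union>C \<in> A" if C: "C \<noteq> {}" "subset.chain A C" for C
  proof -
    have "C \<subseteq> A" using C(2) by (simp add: subset_chain_def)
    then show ?thesis using derives_chain_Union[OF _ C(2,1)] C(1) by (fastforce simp: A_def)
  qed
  moreover have "A \<noteq> {}" using assms by (auto simp: A_def)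
  ultimately obtain M where M: "M \<in> A" "\<And>X. X \<in> A \<Longrightarrow> M \<subseteq> X \<Longrightarrow> X = M"
    using subset_Zorn_nonempty[of A] by metis
  have nd: "\<not> derives \<Lambda> M \<phi>" and sub: "\<Gamma> \<subseteq> M" using M(1) by (auto simp: A_def)
  \<comment> \<open>By maximality, \<phi> becomes derivable as soon as a formula outside
    \<open>M\<close> is added.\<close>
  have imp: "derives \<Lambda> M (Imp \<chi> \<phi>)" if "\<chi> \<notin> M" for \<chi>
    using M(2)[of "insert \<chi> M"] that sub by (intro deduction) (auto simp: A_def)
  have "\<chi> \<in> M \<or> Neg \<chi> \<in> M" for \<chi>
  proof (rule ccontr)
    assume "\<not> ?thesis"
    then have "derives \<Lambda> M (Imp \<chi> \<phi>)" "derives \<Lambda> M (Imp (Neg \<chi>) \<phi>)" using imp by auto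
    moreover have "derives \<Lambda> M (Imp (Imp \<chi> \<phi>) (Imp (Imp (Neg \<chi>) \<phi>) \<phi>))"
      by (auto intro: derives_taut simp: tautology_def)
    ultimately show False using nd by (blast intro: Der_MP)
  qed
  moreover have "derives \<Lambda> M (Imp (Neg Top) \<phi>)"
    by (auto intro: derives_taut simp: tautology_def)
  then have "\<not> derives \<Lambda> M (Neg Top)" using nd by (blast intro: Der_MP)
  ultimately have "mcs \<Lambda> M" by (simp add: mcs_def)
  then show ?thesis using that sub nd Prem by blast
qed

context
  fixes \<Lambda> \<Delta> :: "('a, 'p) fm set"
  assumes mcs: "mcs \<Lambda> \<Delta>"
begin

lemma mcs_derives: "derives \<Lambda> \<Delta> \<chi> \<Longrightarrow> \<chi> \<in> \<Delta>"
proof (rule ccontr)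
  assume \<chi>: "derives \<Lambda> \<Delta> \<chi>" "\<chi> \<notin> \<Delta>"
  then have "derives \<Lambda> \<Delta> (Neg \<chi>)" using mcs by (auto simp: mcs_def intro: Prem)
  moreover have "derives \<Lambda> \<Delta> (Imp \<chi> (Imp (Neg \<chi>) (Neg Top)))"
    by (auto intro: derives_taut simp: tautology_def)
  ultimately show False using mcs \<chi>(1) unfolding mcs_def by (blast intro: Der_MP)
qed

lemma mcs_thm: "SKYR \<Lambda> \<chi> \<Longrightarrow> \<chi> \<in> \<Delta>"
  by (intro mcs_derives Thm)

lemma mcs_MP: "Imp \<phi> \<psi> \<in> \<Delta> \<Longrightarrow> \<phi> \<in> \<Delta> \<Longrightarrow> \<psi> \<in> \<Delta>"
  by (meson Der_MP Prem mcs_derives)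

lemma mcs_SKYR_MP: "SKYR \<Lambda> (Imp \<phi> \<psi>) \<Longrightarrow> \<phi> \<in> \<Delta> \<Longrightarrow> \<psi> \<in> \<Delta>"
  by (blast intro: mcs_MP mcs_thm)

lemma mcs_taut_MP: "tautology (Imp \<phi> \<psi>) \<Longrightarrow> \<phi> \<in> \<Delta> \<Longrightarrow> \<psi> \<in> \<Delta>"
  by (blast intro: mcs_SKYR_MP PT)

lemma mcs_Neg: "Neg \<chi> \<in> \<Delta> \<longleftrightarrow> \<chi> \<notin> \<Delta>"
proof
  assume "Neg \<chi> \<in> \<Delta>"
  moreover have "Imp (Neg \<chi>) (Imp \<chi> (Neg Top)) \<in> \<Delta>"
    by (intro mcs_thm PT) (simp add: tautology_def)
  ultimately show "\<chi> \<notin> \<Delta>"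
    using mcs by (auto simp: mcs_def dest: mcs_MP intro: Prem)
qed (use mcs in \<open>auto simp: mcs_def\<close>)

lemma mcs_Conj: "Conj \<phi> \<psi> \<in> \<Delta> \<longleftrightarrow> \<phi> \<in> \<Delta> \<and> \<psi> \<in> \<Delta>"
proof
  assume "Conj \<phi> \<psi> \<in> \<Delta>"
  then show "\<phi> \<in> \<Delta> \<and> \<psi> \<in> \<Delta>"
    using mcs_taut_MP[of "Conj \<phi> \<psi>"] by (simp add: tautology_def)
next
  assume *: "\<phi> \<in> \<Delta> \<and> \<psi> \<in> \<Delta>"
  have "Imp \<phi> (Imp \<psi> (Conj \<phi> \<psi>)) \<in> \<Delta>"
    by (intro mcs_thm PT) (simp add: tautology_def)
  then show "Conj \<phi> \<psi> \<in> \<Delta>" using * by (blast intro: mcs_MP)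
qed

lemma mcs_Imp: "Imp \<phi> \<psi> \<in> \<Delta> \<longleftrightarrow> (\<phi> \<in> \<Delta> \<longrightarrow> \<psi> \<in> \<Delta>)"
  by (simp add: mcs_Neg mcs_Conj)

lemma mcs_Ky_app:
  assumes "Ky a \<chi> (Imp \<phi> \<psi>) \<in> \<Delta>" "Ky a \<theta> \<phi> \<in> \<Delta>"
  shows "Ky a (Conj \<chi> \<theta>) \<psi> \<in> \<Delta>"
  by (rule mcs_MP[OF mcs_SKYR_MP[OF EKyR assms(1)] assms(2)])

lemma mcs_Ky_antimono:
  assumes "Ky a \<psi> \<chi> \<in> \<Delta>" "K a (Imp \<phi> \<psi>) \<in> \<Delta>"
  shows "Ky a \<phi> \<chi> \<in> \<Delta>"
  by (rule mcs_MP[OF mcs_SKYR_MP[OF IKyR assms(1)] assms(2)])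

end

section \<open>Accessibility between maximal consistent sets\<close>

definition same_K :: "'a \<Rightarrow> ('a, 'p) fm set \<Rightarrow> ('a, 'p) fm set \<Rightarrow> bool" where
  "same_K a \<Gamma> \<Delta> \<longleftrightarrow> (\<forall>\<theta>. K a \<theta> \<in> \<Gamma> \<longleftrightarrow> K a \<theta> \<in> \<Delta>)"

text \<open>Necessitation is applied only to the theorems used in the derivation; \<open>AxK\<close>
  carries \<open>K a\<close> through each modus ponens.\<close>

lemma derives_K_contents:
  assumes "mcs \<Lambda> \<Gamma>" "derives \<Lambda> {\<theta>. K a \<theta> \<in> \<Gamma>} \<chi>"
  shows "K a \<chi> \<in> \<Gamma>"
  using assms(2)
proof (induction rule: derives.induct)
  case (Thm \<phi>)
  then show ?case using assms(1) by (intro mcs_thm NK)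
next
  case (Der_MP \<phi> \<psi>)
  then show ?case using assms(1) by (meson AxK mcs_MP mcs_SKYR_MP)
qed simp

text \<open>By (4) and (5), \<open>K a \<theta>\<close> or its negation is itself known, whichever
  holds in \<Gamma>. So the one-sided inclusion already yields agreement in both directions.\<close>

lemma same_K_if_contents:
  assumes \<Gamma>: "mcs \<Lambda> \<Gamma>" and \<Delta>: "mcs \<Lambda> \<Delta>" and sub: "{\<theta>. K a \<theta> \<in> \<Gamma>} \<subseteq> \<Delta>"
  shows "same_K a \<Gamma> \<Delta>"
  unfolding same_K_def
proof (intro allI iffI)
  fix \<theta> assume "K a \<theta> \<in> \<Gamma>"
  then have "K a (K a \<theta>) \<in> \<Gamma>" by (rule mcs_SKYR_MP[OF \<Gamma> Ax4])
  then show "K a \<theta> \<in> \<Delta>" using sub by auto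
next
  fix \<theta> assume *: "K a \<theta> \<in> \<Delta>"
  show "K a \<theta> \<in> \<Gamma>"
  proof (rule ccontr)
    assume "K a \<theta> \<notin> \<Gamma>"
    then have "Neg (K a \<theta>) \<in> \<Gamma>" by (simp add: mcs_Neg[OF \<Gamma>])
    then have "K a (Neg (K a \<theta>)) \<in> \<Gamma>" by (rule mcs_SKYR_MP[OF \<Gamma> Ax5])
    then have "Neg (K a \<theta>) \<in> \<Delta>" using sub by auto
    then show False using * by (simp add: mcs_Neg[OF \<Delta>])
  qed
qed

text \<open>For the hard direction, a formula that is not known is not derivable from the known
  ones, and \<open>lindenbaum\<close> extends these to an accessible set without it.\<close>

lemma mcs_K:
  assumes \<Gamma>: "mcs \<Lambda> \<Gamma>"
  shows "K a \<chi> \<in> \<Gamma> \<longleftrightarrow> (\<forall>\<Delta>. mcs \<Lambda> \<Delta> \<and> same_K a \<Gamma> \<Delta> \<longrightarrow> \<chi> \<in> \<Delta>)"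
proof (intro iffI allI impI)
  fix \<Delta> assume "K a \<chi> \<in> \<Gamma>" "mcs \<Lambda> \<Delta> \<and> same_K a \<Gamma> \<Delta>"
  then show "\<chi> \<in> \<Delta>" by (meson AxT mcs_SKYR_MP same_K_def)
next
  assume *: "\<forall>\<Delta>. mcs \<Lambda> \<Delta> \<and> same_K a \<Gamma> \<Delta> \<longrightarrow> \<chi> \<in> \<Delta>"
  show "K a \<chi> \<in> \<Gamma>"
  proof (rule ccontr)
    assume "K a \<chi> \<notin> \<Gamma>"
    then have "\<not> derives \<Lambda> {\<theta>. K a \<theta> \<in> \<Gamma>} \<chi>" using derives_K_contents[OF \<Gamma>] by blast
    then obtain \<Delta> where "mcs \<Lambda> \<Delta>" "{\<theta>. K a \<theta> \<in> \<Gamma>} \<subseteq> \<Delta>" "\<chi> \<notin> \<Delta>"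
      by (rule lindenbaum)
    then show False using * same_K_if_contents[OF \<Gamma>] by blast
  qed
qed

text \<open>(4YKR) turns the formula into a known one, which accessible sets share, and (T) unboxes
  it.\<close>

lemma same_K_Ky:
  assumes "mcs \<Lambda> \<Gamma>" "mcs \<Lambda> \<Delta>" "same_K a \<Gamma> \<Delta>" "Ky a \<phi> \<psi> \<in> \<Gamma>"
  shows "Ky a \<phi> \<psi> \<in> \<Delta>"
  using assms by (meson AxT YKR4 mcs_SKYR_MP same_K_def)

section \<open>Explanation terms\<close>

text \<open>\<open>Wit a \<chi> \<psi> n\<close> is meant to explain \<psi> to \<open>a\<close> at
  the \<chi>-worlds of those cells of \<open>a\<close> whose tag is \<open>n\<close>.\<close>

datatype ('a, 'p) expl =
    Unit
  | Wit 'a "('a, 'p) fm" "('a, 'p) fm" nat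
  | App "('a, 'p) expl" "('a, 'p) expl"

text \<open>Admissibility splits into a set of formulas independent of the world and a set of
  worlds, \<open>active\<close>, independent of the formula. The application condition of models is
  then immediate.\<close>

primrec explained :: "('a, 'p) fm set \<Rightarrow> ('a, 'p) expl \<Rightarrow> ('a, 'p) fm set" where
  "explained \<Lambda> Unit = \<Lambda>"
| "explained \<Lambda> (Wit a \<chi> \<psi> n) = {\<psi>}"
| "explained \<Lambda> (App s t) = {\<psi>. \<exists>\<phi>\<in>explained \<Lambda> t. Imp \<phi> \<psi> \<in> explained \<Lambda> s}"

primrec active :: "('a, 'p) fm set \<times> ('a \<Rightarrow> nat) \<Rightarrow> ('a, 'p) expl \<Rightarrow> bool" where
  "active w Unit \<longleftrightarrow> True"
| "active w (Wit a \<chi> \<psi> n) \<longleftrightarrow> snd w a = n \<and> Ky a \<chi> \<psi> \<in> fst w \<and> \<chi> \<in> fst w"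
| "active w (App s t) \<longleftrightarrow> active w s \<and> active w t"

primrec condition :: "('a, 'p) expl \<Rightarrow> ('a, 'p) fm" where
  "condition Unit = Top"
| "condition (Wit a \<chi> \<psi> n) = \<chi>"
| "condition (App s t) = Conj (condition s) (condition t)"

text \<open>The bound is strict, hence \<open>Suc\<close>: the number \<open>tag_bound t\<close>
  itself is already a fresh tag for \<open>t\<close>.\<close>

primrec tag_bound :: "('a, 'p) expl \<Rightarrow> nat" where
  "tag_bound Unit = 0"
| "tag_bound (Wit a \<chi> \<psi> n) = Suc n"
| "tag_bound (App s t) = max (tag_bound s) (tag_bound t)"

lemma active_condition:
  assumes "mcs \<Lambda> (fst w)"
  shows "active w t \<Longrightarrow> condition t \<in> fst w"
proof (induction t)
  case Unit
  have "Top \<in> fst w" by (intro mcs_thm[OF assms] PT) (simp add: tautology_def)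
  then show ?case by simp
qed (auto simp: mcs_Conj[OF assms])

text \<open>Each active witness belongs to \<open>a\<close> and brings its own \<open>Ky\<close>
  formula. (EKyR) composes these along \<open>App\<close>, collecting conditions just as
  \<open>condition\<close> does; (NKyR) covers \<open>Unit\<close>.\<close>

lemma active_fresh_Ky:
  assumes w: "mcs \<Lambda> (fst w)" and fresh: "\<And>b. b \<noteq> a \<Longrightarrow> tag_bound t \<le> snd w b"
  shows "active w t \<Longrightarrow> \<psi> \<in> explained \<Lambda> t \<Longrightarrow> Ky a (condition t) \<psi> \<in> fst w"
  using fresh
proof (induction t arbitrary: \<psi>)
  case Unit
  then have "SKYR \<Lambda> (Ky a Top \<psi>)" by (intro NKyR) simp
  then show ?case by (simp add: mcs_thm[OF w])
next
  case (Wit b \<chi> \<theta> n)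
  \<comment> \<open>Activity forces the tag of \<open>b\<close> to be \<open>n\<close>, while
    freshness would give at least \<open>Suc n\<close> for any other agent.\<close>
  then have "b = a" by force
  then show ?case using Wit by simp
next
  case (App s t)
  then obtain \<phi> where "\<phi> \<in> explained \<Lambda> t" "Imp \<phi> \<psi> \<in> explained \<Lambda> s" by auto
  then have "Ky a (condition s) (Imp \<phi> \<psi>) \<in> fst w" "Ky a (condition t) \<phi> \<in> fst w"
    using App by auto
  then show ?case by (simp add: mcs_Ky_app[OF w])
qed

section \<open>The canonical model\<close>

definition canonical ::
  "('a, 'p) fm set \<Rightarrow> ('a, 'p, ('a, 'p) fm set \<times> ('a \<Rightarrow> nat), ('a, 'p) expl) model" where
  "canonical \<Lambda> =
    \<lparr> worlds = {w. mcs \<Lambda> (fst w)},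
      expls = UNIV,
      unit_expl = Unit,
      app_expl = App,
      rel = (\<lambda>a. {(w, v). mcs \<Lambda> (fst w) \<and> mcs \<Lambda> (fst v) \<and>
                     same_K a (fst w) (fst v) \<and> snd w a = snd v a}),
      adm = (\<lambda>t \<phi>. {w. mcs \<Lambda> (fst w) \<and> active w t \<and> \<phi> \<in> explained \<Lambda> t}),
      val = (\<lambda>p. {w. mcs \<Lambda> (fst w) \<and> Atom p \<in> fst w}) \<rparr>"

text \<open>The given maximal consistent set makes the set of worlds nonempty.\<close>

lemma s5_model_canonical:
  assumes "mcs \<Lambda> \<Delta>"
  shows "s5_model \<Lambda> (canonical \<Lambda>)"
proof -
  have "equiv (worlds (canonical \<Lambda>)) (rel (canonical \<Lambda>) a)" for a
    by (auto simp: canonical_def equiv_def refl_on_def sym_def trans_def same_K_def)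
  then show ?thesis
    using assms by (auto simp: s5_model_def canonical_def)
qed

lemma truth:
  "mcs \<Lambda> \<Gamma> \<Longrightarrow> sat (canonical \<Lambda>) (\<Gamma>, f) \<phi> \<longleftrightarrow> \<phi> \<in> \<Gamma>"
proof (induction \<phi> arbitrary: \<Gamma> f)
  case (Atom p)
  then show ?case by (simp add: canonical_def)
next
  case (Neg \<phi>)
  then show ?case by (simp add: mcs_Neg[OF Neg.prems])
next
  case (Conj \<phi> \<psi>)
  then show ?case by (simp add: mcs_Conj[OF Conj.prems])
next
  case (K a \<phi>)
  have "sat (canonical \<Lambda>) (\<Gamma>, f) (K a \<phi>) \<longleftrightarrow>
      (\<forall>\<Delta> g. mcs \<Lambda> \<Delta> \<and> same_K a \<Gamma> \<Delta> \<and> f a = g a \<longrightarrow> sat (canonical \<Lambda>) (\<Delta>, g) \<phi>)"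
    using K.prems by (auto simp: canonical_def)
  \<comment> \<open>The tags drop out, since \<open>g = f\<close> always meets the tag
    requirement.\<close>
  also have "\<dots> \<longleftrightarrow> (\<forall>\<Delta>. mcs \<Lambda> \<Delta> \<and> same_K a \<Gamma> \<Delta> \<longrightarrow> \<phi> \<in> \<Delta>)"
    by (auto simp: K.IH)
  also have "\<dots> \<longleftrightarrow> K a \<phi> \<in> \<Gamma>" by (rule mcs_K[OF K.prems, symmetric])
  finally show ?case .
next
  case (Ky a \<phi> \<psi>)
  note \<Gamma> = Ky.prems
  have "sat (canonical \<Lambda>) (\<Gamma>, f) (Ky a \<phi> \<psi>) \<longleftrightarrow>
      (\<exists>t. \<forall>\<Delta> g. mcs \<Lambda> \<Delta> \<and> same_K a \<Gamma> \<Delta> \<and> f a = g a \<and> sat (canonical \<Lambda>) (\<Delta>, g) \<phi> \<longrightarrow>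
        active (\<Delta>, g) t \<and> \<psi> \<in> explained \<Lambda> t \<and> sat (canonical \<Lambda>) (\<Delta>, g) \<psi>)"
    using \<Gamma> by (simp add: canonical_def)
  also have "\<dots> \<longleftrightarrow> (\<exists>t. \<forall>\<Delta> g. mcs \<Lambda> \<Delta> \<and> same_K a \<Gamma> \<Delta> \<and> f a = g a \<and> \<phi> \<in> \<Delta> \<longrightarrow>
        active (\<Delta>, g) t \<and> \<psi> \<in> explained \<Lambda> t \<and> \<psi> \<in> \<Delta>)"
    by (simp add: Ky.IH cong: conj_cong)
  also have "\<dots> \<longleftrightarrow> Ky a \<phi> \<psi> \<in> \<Gamma>"
  proof
    assume Ky: "Ky a \<phi> \<psi> \<in> \<Gamma>"
    then have K: "K a (Imp \<phi> \<psi>) \<in> \<Gamma>" by (rule mcs_SKYR_MP[OF \<Gamma> DKyR])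
    \<comment> \<open>The witness is indexed by the tag of \<open>a\<close>, which is constant on
      the cell.\<close>
    have "active (\<Delta>, g) (Wit a \<phi> \<psi> (f a)) \<and> \<psi> \<in> explained \<Lambda> (Wit a \<phi> \<psi> (f a)) \<and> \<psi> \<in> \<Delta>"
      if "mcs \<Lambda> \<Delta> \<and> same_K a \<Gamma> \<Delta> \<and> f a = g a \<and> \<phi> \<in> \<Delta>" for \<Delta> g
    proof -
      have "Ky a \<phi> \<psi> \<in> \<Delta>" using same_K_Ky[OF \<Gamma>] that Ky by blast
      moreover have "Imp \<phi> \<psi> \<in> \<Delta>" using K mcs_K[OF \<Gamma>, of a "Imp \<phi> \<psi>"] that by blast
      ultimately show ?thesis using that mcs_MP[of \<Lambda> \<Delta> \<phi> \<psi>] by simp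
    qed
    then show "\<exists>t. \<forall>\<Delta> g. mcs \<Lambda> \<Delta> \<and> same_K a \<Gamma> \<Delta> \<and> f a = g a \<and> \<phi> \<in> \<Delta> \<longrightarrow>
        active (\<Delta>, g) t \<and> \<psi> \<in> explained \<Lambda> t \<and> \<psi> \<in> \<Delta>" by blast
  next
    assume "\<exists>t. \<forall>\<Delta> g. mcs \<Lambda> \<Delta> \<and> same_K a \<Gamma> \<Delta> \<and> f a = g a \<and> \<phi> \<in> \<Delta> \<longrightarrow>
        active (\<Delta>, g) t \<and> \<psi> \<in> explained \<Lambda> t \<and> \<psi> \<in> \<Delta>"
    then obtain t where t: "\<And>\<Delta> g. mcs \<Lambda> \<Delta> \<Longrightarrow> same_K a \<Gamma> \<Delta> \<Longrightarrow> f a = g a \<Longrightarrow> \<phi> \<in> \<Delta> \<Longrightarrow>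
        active (\<Delta>, g) t \<and> \<psi> \<in> explained \<Lambda> t" by blast
    show "Ky a \<phi> \<psi> \<in> \<Gamma>"
    \<comment> \<open>Without a \<phi>-world in the cell, \<open>t\<close> is constrained nowhere
      and says nothing about \<psi>; (UKyR) settles this case.\<close>
    proof (cases "K a (Neg \<phi>) \<in> \<Gamma>")
      case True
      then show ?thesis by (rule mcs_SKYR_MP[OF \<Gamma> UKyR])
    next
      case False
      then obtain \<Delta> where \<Delta>: "mcs \<Lambda> \<Delta>" "same_K a \<Gamma> \<Delta>" "\<phi> \<in> \<Delta>"
        by (auto simp: mcs_K[OF \<Gamma>, of a "Neg \<phi>"] mcs_Neg)
      \<comment> \<open>Keeping the tag of \<open>a\<close> stays in the cell; all other agents
        receive a tag fresh for \<open>t\<close>.\<close>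
      define g where "g b = (if b = a then f a else tag_bound t)" for b
      have "Ky a (condition t) \<psi> \<in> \<Delta>"
        using active_fresh_Ky[of \<Lambda> "(\<Delta>, g)" a t \<psi>] t[OF \<Delta>(1,2) _ \<Delta>(3), of g] \<Delta>(1)
        by (simp add: g_def)
      moreover have "same_K a \<Delta> \<Gamma>" using \<Delta>(2) by (simp add: same_K_def)
      ultimately have "Ky a (condition t) \<psi> \<in> \<Gamma>" using same_K_Ky[OF \<Delta>(1) \<Gamma>] by simp
      \<comment> \<open>Freshness is not at stake here: \<open>t\<close> is active at every
        \<phi>-world of the cell, in particular at those with tags \<open>f\<close>.\<close>
      moreover have "Imp \<phi> (condition t) \<in> \<Theta>" if \<Theta>: "mcs \<Lambda> \<Theta>" "same_K a \<Gamma> \<Theta>" for \<Theta>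
        using t[OF \<Theta>, of f] active_condition[of \<Lambda> "(\<Theta>, f)" t] \<Theta>(1) by (simp add: mcs_Imp[OF \<Theta>(1)])
      then have "K a (Imp \<phi> (condition t)) \<in> \<Gamma>"
        using mcs_K[OF \<Gamma>, of a "Imp \<phi> (condition t)"] by blast
      ultimately show ?thesis by (rule mcs_Ky_antimono[OF \<Gamma>])
    qed
  qed
  finally show ?case .
qed

theorem theorem3p26:
  fixes \<Lambda> \<Gamma> :: "('a::countable, 'p::{countable, infinite}) fm set"
    and \<phi> :: "('a, 'p) fm"
  assumes "\<And>\<chi>. \<chi> \<in> \<Lambda> \<Longrightarrow> valid TYPE('w::infinite) TYPE('e::infinite) \<Lambda> \<chi>"
    and "consequence TYPE('w) TYPE('e) \<Lambda> \<Gamma> \<phi>"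
  shows "derives \<Lambda> \<Gamma> \<phi>"
proof (rule ccontr)
  assume "\<not> derives \<Lambda> \<Gamma> \<phi>"
  then obtain \<Delta> where \<Delta>: "mcs \<Lambda> \<Delta>" "\<Gamma> \<subseteq> \<Delta>" "\<phi> \<notin> \<Delta>" by (rule lindenbaum)
  \<comment> \<open>The canonical worlds form an uncountable type, so the hypothesis is transferred
    by the downward Loewenheim-Skolem argument.\<close>
  have "consequence TYPE(('a, 'p) fm set \<times> ('a \<Rightarrow> nat)) TYPE(('a, 'p) expl) \<Lambda> \<Gamma> \<phi>"
    using assms(2) by (rule consequence_all_types)
  \<comment> \<open>By \<open>truth\<close>, any tags would serve as well as the constant 0.\<close>
  moreover have "(\<Delta>, \<lambda>_. 0) \<in> worlds (canonical \<Lambda>)" using \<Delta>(1) by (simp add: canonical_def)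
  moreover have "\<forall>\<gamma>\<in>\<Gamma>. sat (canonical \<Lambda>) (\<Delta>, \<lambda>_. 0) \<gamma>"
    using \<Delta>(2) by (auto simp: truth[OF \<Delta>(1)])
  ultimately have "sat (canonical \<Lambda>) (\<Delta>, \<lambda>_. 0) \<phi>"
    using s5_model_canonical[OF \<Delta>(1)] unfolding consequence_def by blast
  then show False using \<Delta>(3) by (simp add: truth[OF \<Delta>(1)])
qed

end
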